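(* Let $G$ be a finite group of order $L\ge2$. If $$\tilde p>\sqrt{\frac{4\log L}{L-1}},$$ then there is a (computationally inefficient) algorithm that can distinguish between the spiked model $\mathrm{ToH}_n(\tilde p,G)$ and the unspiked model $\mathrm{ToH}_n(0,G)$; that is, there is a sequence of tests, taking the observed matrix $Y$ as input, whose type I and type II error probabilities both tend to $0$ as $n\to\infty$.
   Context: Truth-or-Haar model $\mathrm{ToH}_n(\tilde p,G)$ (for a finite group $G$, $\tilde p\ge0$, and $n$ large enough that $p:=\tilde p/\sqrt n\le1$): draw $g\in G^n$ with coordinates $g_u$ independent and uniform on $G$. Independently for each unordered pair $\{u,v\}$ with $u\ne v$, say $u<v$: with probability $p=\tilde p/\sqrt n$ let $Y_{uv}=g_ug_v^{-1}$, and otherwise let $Y_{uv}$ be uniform on $G$ (independent of everything else). Define $Y_{vu}=(Y_{uv})^{-1}$ and $Y_{uu}=1$ (the identity). The model is the law of the matrix $Y\in G^{n\times n}$. *)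

theory Defs
  imports "HOL-Probability.Probability" "HOL-Algebra.Algebra"
begin

text \<open>
  Vertices are \<open>0, \<dots>, n - 1\<close>. An element of \<open>G\<^sup>n\<close> is an extensional function on
  \<open>{..<n}\<close>, and a matrix in \<open>G\<close> to the power \<open>n \<times> n\<close> is an extensional function on
  \<open>{..<n} \<times> {..<n}\<close>; both take the value \<open>undefined\<close> outside their domain, so a test
  applied to the matrix sees its \<open>n\<^sup>2\<close> entries and nothing else.
\<close>

definition toh_pairs :: "nat \<Rightarrow> (nat \<times> nat) set" where
  "toh_pairs n = {(u, v). u < v \<and> v < n}"

definition toh_entry ::
  "('a, 'b) monoid_scheme \<Rightarrow> real \<Rightarrow> 'a \<Rightarrow> 'a \<Rightarrow> 'a pmf" where
  "toh_entry G p a b =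
     bind_pmf (bernoulli_pmf p)
       (\<lambda>truth. if truth then return_pmf (a \<otimes>\<^bsub>G\<^esub> inv\<^bsub>G\<^esub> b) else pmf_of_set (carrier G))"

definition toh_matrix ::
  "('a, 'b) monoid_scheme \<Rightarrow> nat \<Rightarrow> (nat \<times> nat \<Rightarrow> 'a) \<Rightarrow> nat \<times> nat \<Rightarrow> 'a" where
  "toh_matrix G n y =
     (\<lambda>(u, v) \<in> {..<n} \<times> {..<n}.
        if u < v then y (u, v)
        else if v < u then inv\<^bsub>G\<^esub> (y (v, u))
        else \<one>\<^bsub>G\<^esub>)"

text \<open>
  The model is meant for \<open>n\<close> so large that \<open>p = pt / sqrt n \<le> 1\<close>. For the finitely many
  other \<open>n\<close> the library's Bernoulli distribution truncates its parameter to \<open>[0, 1]\<close>;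
  these values play no role in statements about \<open>n \<rightarrow> \<infinity>\<close>.
\<close>

definition ToH ::
  "nat \<Rightarrow> real \<Rightarrow> ('a, 'b) monoid_scheme \<Rightarrow> (nat \<times> nat \<Rightarrow> 'a) pmf" where
  "ToH n pt G =
     bind_pmf (Pi_pmf {..<n} undefined (\<lambda>_. pmf_of_set (carrier G)))
       (\<lambda>g. map_pmf (toh_matrix G n)
          (Pi_pmf (toh_pairs n) undefined
            (\<lambda>(u, v). toh_entry G (pt / sqrt (real n)) (g u) (g v))))"

text \<open>
  A test returns \<open>True\<close> to reject the null hypothesis \<open>P\<close> in favour of the alternative \<open>Q\<close>.
\<close>

definition type_I_error :: "'c pmf \<Rightarrow> ('c \<Rightarrow> bool) \<Rightarrow> real" where
  "type_I_error P test = measure_pmf.prob P {y. test y}"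

definition type_II_error :: "'c pmf \<Rightarrow> ('c \<Rightarrow> bool) \<Rightarrow> real" where
  "type_II_error Q test = measure_pmf.prob Q {y. \<not> test y}"

end

theory Submission
  imports Defs "HOL-Real_Asymp.Real_Asymp"
begin

text \<open>
  For a labelling \<open>h\<close> let the score of \<open>h\<close> be the number of pairs \<open>u < v\<close> with
  \<open>Y (u, v) = h u (h v)\<^sup>-\<^sup>1\<close>, and let the test reject when some labelling has score at least
  \<open>N / L + b n\<^sup>3\<^sup>/\<^sup>2\<close>, where \<open>N\<close> is the number of pairs. With no signal each score is binomial
  with parameters \<open>N\<close> and \<open>1 / L\<close>. The Chernoff bound with parameter \<open>2 b / (\<sigma>\<^sup>2 \<surd>n)\<close>, where
  \<open>\<sigma>\<^sup>2 = (1 / L) (1 - 1 / L)\<close>, gives the tail \<open>exp (- n b\<^sup>2 / \<sigma>\<^sup>2 + o(n))\<close>, which beats the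
  union bound over the \<open>L\<^sup>n\<close> labellings once \<open>b\<^sup>2 > \<sigma>\<^sup>2 ln L\<close>. With signal the score of the
  planted labelling exceeds \<open>N / L\<close> by about \<open>(1 - 1 / L) (pt / 2) n\<^sup>3\<^sup>/\<^sup>2\<close>. The condition on
  \<open>pt\<close> says exactly that some \<open>b\<close> fits between the two.
\<close>

section \<open>A Chernoff bound for the number of matches in independent coordinates\<close>

lemma exp_le_quadratic:
  fixes y l :: real
  assumes "\<bar>y\<bar> \<le> l"
  shows "exp y \<le> 1 + y + exp l / 2 * y\<^sup>2"
proof -
  obtain t where t: "\<bar>t\<bar> \<le> \<bar>y\<bar>" "exp y = (\<Sum>m<2. y ^ m / fact m) + exp t / fact 2 * y ^ 2"
    using Maclaurin_exp_le[of y 2] by blast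
  have "exp t / 2 * y\<^sup>2 \<le> exp l / 2 * y\<^sup>2"
    using t(1) assms by (intro mult_right_mono divide_right_mono) auto
  then show ?thesis
    using t(2) by (simp add: numeral_2_eq_2)
qed

text \<open>The left side is the moment generating function at \<open>l\<close> of a centred
  Bernoulli(\<open>q\<close>) variable. Expanding both exponentials to second order, the linear
  terms cancel and the quadratic ones add up to the variance \<open>q * (1 - q)\<close>. Keeping
  this variance, where Hoeffding's lemma would put 1/4, is what yields the sharp constant under the
  null; the factor \<open>exp \<bar>l\<bar>\<close> tends to 1 as \<open>l\<close> tends to
  0.\<close>

lemma bernoulli_mgf_le:
  fixes q l :: real
  assumes "0 \<le> q" "q \<le> 1"
  shows "exp (- l * q) + q * (exp (l * (1 - q)) - exp (- l * q))
    \<le> exp (q * (1 - q) * l\<^sup>2 * exp \<bar>l\<bar> / 2)"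
proof -
  have 1: "exp (l * (1 - q)) \<le> 1 + l * (1 - q) + exp \<bar>l\<bar> / 2 * (l * (1 - q))\<^sup>2"
    using assms by (intro exp_le_quadratic) (simp add: abs_mult mult_left_le)
  have 2: "exp (- l * q) \<le> 1 + - l * q + exp \<bar>l\<bar> / 2 * (- l * q)\<^sup>2"
    using assms by (intro exp_le_quadratic) (simp add: abs_mult mult_left_le)
  have "exp (- l * q) + q * (exp (l * (1 - q)) - exp (- l * q))
      = q * exp (l * (1 - q)) + (1 - q) * exp (- l * q)"
    by (simp add: algebra_simps)
  also have "\<dots> \<le> q * (1 + l * (1 - q) + exp \<bar>l\<bar> / 2 * (l * (1 - q))\<^sup>2)
      + (1 - q) * (1 + - l * q + exp \<bar>l\<bar> / 2 * (- l * q)\<^sup>2)"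
    using assms by (intro add_mono mult_left_mono 1 2) auto
  also have "\<dots> = 1 + q * (1 - q) * l\<^sup>2 * exp \<bar>l\<bar> / 2"
    by (simp add: power2_eq_square field_simps)
  also have "\<dots> \<le> exp (q * (1 - q) * l\<^sup>2 * exp \<bar>l\<bar> / 2)"
    by (rule exp_ge_add_one_self)
  finally show ?thesis .
qed

text \<open>The laws \<open>P x\<close> may differ, but coordinate \<open>x\<close> hits its target
  \<open>c x\<close> with the same probability \<open>q\<close>, so the number of hits is binomial
  and Markov's inequality for its exponential applies. The sign of \<open>l\<close> is free:
  positive for the upper tail, negative for the lower.\<close>

lemma Chernoff_matches:
  fixes P :: "'i \<Rightarrow> 'a pmf" and q l t :: real
  assumes "finite A" and q: "\<And>x. x \<in> A \<Longrightarrow> pmf (P x) (c x) = q" and "0 \<le> q" "q \<le> 1"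
  shows "measure_pmf.prob (Pi_pmf A d P)
      {y. l * (real (card {x \<in> A. y x = c x}) - q * real (card A)) \<ge> t}
    \<le> exp (real (card A) * (q * (1 - q) * l\<^sup>2 * exp \<bar>l\<bar> / 2) - t)"
proof -
  let ?M = "Pi_pmf A d P"
  define f :: "'i \<Rightarrow> 'a \<Rightarrow> real" where "f x v = exp (l * (of_bool (v = c x) - q))" for x v
  \<comment> \<open>Affine in an indicator, so that the expectation of \<open>f x\<close> becomes
    literally the left side of \<open>bernoulli_mgf_le\<close>.\<close>
  have f_eq: "f x v = exp (- l * q) + indicator {c x} v * (exp (l * (1 - q)) - exp (- l * q))"
    for x v by (auto simp: f_def indicator_def)
  have f_ind: "integrable (measure_pmf (P x)) (indicator {c x} :: 'a \<Rightarrow> real)" for x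
    by (rule measure_pmf.integrable_const_bound[where B = 1]) (auto simp: indicator_def)
  have f_int: "integrable (measure_pmf (P x)) (f x)" for x
    by (rule measure_pmf.integrable_const_bound[where B = "exp (- l * q) + exp (l * (1 - q))"])
      (auto simp: f_def)
  have f_nonneg: "0 \<le> f x v" for x v
    by (simp add: f_def)
  have f_exp: "measure_pmf.expectation (P x) (f x) \<le> exp (q * (1 - q) * l\<^sup>2 * exp \<bar>l\<bar> / 2)"
    if "x \<in> A" for x
  proof -
    have "measure_pmf.expectation (P x) (f x)
        = exp (- l * q) + q * (exp (l * (1 - q)) - exp (- l * q))"
      unfolding f_eq using q[OF that] f_ind[of x]
      by (subst Bochner_Integration.integral_add) (auto simp: measure_pmf_single)
    then show ?thesis
      using bernoulli_mgf_le[OF assms(3,4), of l] by simp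
  qed
  have prod_eq: "(\<Prod>x\<in>A. f x (y x))
      = exp (l * (real (card {x \<in> A. y x = c x}) - q * real (card A)))" for y
  proof -
    have "(\<Sum>x\<in>A. of_bool (y x = c x) :: real) = real (card {x \<in> A. y x = c x})"
      using \<open>finite A\<close> by (simp add: Int_def)
    then show ?thesis
      unfolding f_def exp_sum[OF \<open>finite A\<close>, symmetric] sum_distrib_left[symmetric]
      by (simp add: sum_subtractf mult.commute)
  qed
  \<comment> \<open>A crude bound, serving only the integrability of the product.\<close>
  have f_bd: "(\<Prod>x\<in>A. f x (y x)) \<le> exp (\<bar>l\<bar> * (1 + q)) ^ card A" for y
  proof (rule order.trans[OF prod_mono])
    fix x assume "x \<in> A"
    have "l * (of_bool (y x = c x) - q) \<le> \<bar>l\<bar> * \<bar>of_bool (y x = c x) - q\<bar>"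
      by (metis abs_ge_self abs_mult)
    also have "\<dots> \<le> \<bar>l\<bar> * (1 + q)"
      using assms by (intro mult_left_mono) auto
    finally show "0 \<le> f x (y x) \<and> f x (y x) \<le> exp (\<bar>l\<bar> * (1 + q))"
      by (simp add: f_def)
  qed simp
  have int: "integrable (measure_pmf ?M) (\<lambda>y. \<Prod>x\<in>A. f x (y x))"
    by (rule measure_pmf.integrable_const_bound[where B = "exp (\<bar>l\<bar> * (1 + q)) ^ card A"])
      (use f_bd in \<open>auto simp: abs_prod f_def\<close>)
  have "measure_pmf.prob ?M {y. l * (real (card {x \<in> A. y x = c x}) - q * real (card A)) \<ge> t}
      = measure_pmf.prob ?M {y \<in> space ?M. (\<Prod>x\<in>A. f x (y x)) \<ge> exp t}"
    by (simp add: prod_eq)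
  also have "\<dots> \<le> measure_pmf.expectation ?M (\<lambda>y. \<Prod>x\<in>A. f x (y x)) / exp t"
    by (rule integral_Markov_inequality_measure[where A = "{}"])
      (use int f_nonneg in \<open>auto intro!: prod_nonneg\<close>)
  also have "measure_pmf.expectation ?M (\<lambda>y. \<Prod>x\<in>A. f x (y x))
      = (\<Prod>x\<in>A. measure_pmf.expectation (P x) (f x))"
    by (rule expectation_prod_Pi_pmf) (use \<open>finite A\<close> f_int f_nonneg in auto)
  also have "\<dots> \<le> (\<Prod>x\<in>A. exp (q * (1 - q) * l\<^sup>2 * exp \<bar>l\<bar> / 2))"
    using f_exp by (intro prod_mono conjI integral_nonneg_AE) (auto simp: f_nonneg)
  also have "\<dots> / exp t = exp (real (card A) * (q * (1 - q) * l\<^sup>2 * exp \<bar>l\<bar> / 2) - t)"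
    unfolding exp_diff exp_of_nat_mult by simp
  finally show ?thesis
    by (simp add: divide_right_mono)
qed

section \<open>Reduction of the model to independent entries above the diagonal\<close>

lemma prob_bind_pmf_le:
  assumes "\<And>x. x \<in> set_pmf M \<Longrightarrow> measure_pmf.prob (f x) A \<le> c"
  shows "measure_pmf.prob (bind_pmf M f) A \<le> c"
proof -
  have c: "0 \<le> c"
    using assms set_pmf_not_empty[of M] measure_nonneg order.trans by (metis ex_in_conv)
  have "emeasure (bind_pmf M f) A = (\<integral>\<^sup>+x. emeasure (f x) A \<partial>M)"
    by simp
  also have "\<dots> \<le> (\<integral>\<^sup>+x. ennreal c \<partial>M)"
    using assms by (intro nn_integral_mono_AE)
      (auto simp: AE_measure_pmf_iff measure_pmf.emeasure_eq_measure ennreal_leI)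
  also have "\<dots> = ennreal c"
    by simp
  finally show ?thesis
    using c by (simp add: measure_pmf.emeasure_eq_measure)
qed

lemma finite_toh_pairs [simp]: "finite (toh_pairs n)"
  by (rule finite_subset[of _ "{..<n} \<times> {..<n}"]) (auto simp: toh_pairs_def)

lemma card_toh_pairs: "real (card (toh_pairs n)) = real n * (real n - 1) / 2"
proof (induction n)
  case 0
  then show ?case by (simp add: toh_pairs_def)
next
  case (Suc n)
  have "toh_pairs (Suc n) = toh_pairs n \<union> (\<lambda>u. (u, n)) ` {..<n}"
    by (auto simp: toh_pairs_def less_Suc_eq)
  moreover have "toh_pairs n \<inter> (\<lambda>u. (u, n)) ` {..<n} = {}"
    by (auto simp: toh_pairs_def)
  moreover have "card ((\<lambda>u. (u, n)) ` {..<n}) = n"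
    by (simp add: card_image inj_on_def)
  ultimately show ?case
    using Suc by (simp add: card_Un_disjoint field_simps)
qed

text \<open>Used in two cases: at \<open>p = 0\<close>, where every group element has mass 1/L, and
  at \<open>x\<close> equal to the true ratio, which gives the match probability of the planted
  labelling.\<close>

lemma pmf_toh_entry:
  assumes "group G" "finite (carrier G)" "0 \<le> p" "p \<le> 1" "x \<in> carrier G"
  shows "pmf (toh_entry G p a b) x
    = p * of_bool (x = a \<otimes>\<^bsub>G\<^esub> inv\<^bsub>G\<^esub> b) + (1 - p) / real (order G)"
proof -
  interpret group G by fact
  have "carrier G \<noteq> {}" by auto
  then show ?thesis
    using assms by (simp add: toh_entry_def pmf_bind order_def indicator_def)
qed

text \<open>Given the labelling \<open>h\<close>, the likelihood of the observed matrix increases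
  with this count when 0 < p < 1, so scanning for the largest score amounts to maximum
  likelihood.\<close>

definition toh_score ::
  "('a, 'b) monoid_scheme \<Rightarrow> nat \<Rightarrow> (nat \<Rightarrow> 'a) \<Rightarrow> (nat \<times> nat \<Rightarrow> 'a) \<Rightarrow> real" where
  "toh_score G n h Y = real (card {x \<in> toh_pairs n. Y x = h (fst x) \<otimes>\<^bsub>G\<^esub> inv\<^bsub>G\<^esub> (h (snd x))})"

lemma toh_score_matrix: "toh_score G n h (toh_matrix G n y) = toh_score G n h y"
  unfolding toh_score_def
  by (intro arg_cong[where f = "\<lambda>S. real (card S)"]) (auto simp: toh_pairs_def toh_matrix_def)

text \<open>Given the planted labelling \<open>g\<close> the entries are independent, so a bound
  uniform in \<open>g\<close> passes to the mixture.\<close>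

lemma prob_ToH_le:
  assumes "group G" "finite (carrier G)"
    and "\<And>g. g \<in> {..<n} \<rightarrow>\<^sub>E carrier G \<Longrightarrow>
      measure_pmf.prob (Pi_pmf (toh_pairs n) undefined
        (\<lambda>(u, v). toh_entry G (pt / sqrt (real n)) (g u) (g v))) {y. toh_matrix G n y \<in> A} \<le> c"
  shows "measure_pmf.prob (ToH n pt G) A \<le> c"
  unfolding ToH_def
proof (rule prob_bind_pmf_le)
  interpret group G by fact
  fix g assume "g \<in> set_pmf (Pi_pmf {..<n} undefined (\<lambda>_. pmf_of_set (carrier G)))"
  moreover have "carrier G \<noteq> {}" by auto
  ultimately have "g \<in> {..<n} \<rightarrow>\<^sub>E carrier G"
    using assms(2) by (auto simp: set_Pi_pmf PiE_dflt_def PiE_def extensional_def)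
  from assms(3)[OF this]
  show "measure_pmf.prob (map_pmf (toh_matrix G n) (Pi_pmf (toh_pairs n) undefined
      (\<lambda>(u, v). toh_entry G (pt / sqrt (real n)) (g u) (g v)))) A \<le> c"
    by (simp add: vimage_def)
qed

section \<open>Error bounds for fixed n, with a free Chernoff parameter\<close>

lemma prob_null_score_ge:
  fixes G :: "('a, 'b) monoid_scheme" and n :: nat and l s :: real
  assumes "group G" "finite (carrier G)" "h \<in> {..<n} \<rightarrow> carrier G" "0 \<le> l"
  defines "q \<equiv> 1 / real (order G)" and "N \<equiv> real (card (toh_pairs n))"
  shows "measure_pmf.prob (ToH n 0 G) {Y. toh_score G n h Y \<ge> q * N + s}
    \<le> exp (N * (q * (1 - q) * l\<^sup>2 * exp l / 2) - l * s)"
proof (rule prob_ToH_le[OF assms(1,2)])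
  interpret group G by fact
  fix g :: "nat \<Rightarrow> 'a"
  let ?P = "\<lambda>(u, v). toh_entry G (0 / sqrt (real n)) (g u) (g v)"
  let ?c = "\<lambda>x. h (fst x) \<otimes>\<^bsub>G\<^esub> inv\<^bsub>G\<^esub> (h (snd x))"
  have ord: "order G > 0"
    using assms(2) order_gt_0_iff_finite by blast
  have c: "?c x \<in> carrier G" if "x \<in> toh_pairs n" for x
    using that assms(3) by (auto simp: toh_pairs_def Pi_iff)
  have "measure_pmf.prob (Pi_pmf (toh_pairs n) undefined ?P)
      {y. toh_matrix G n y \<in> {Y. toh_score G n h Y \<ge> q * N + s}}
    \<le> measure_pmf.prob (Pi_pmf (toh_pairs n) undefined ?P)
      {y. l * (real (card {x \<in> toh_pairs n. y x = ?c x}) - q * real (card (toh_pairs n))) \<ge> l * s}"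
  proof (intro measure_pmf.finite_measure_mono subsetI CollectI)
    fix y assume "y \<in> {y. toh_matrix G n y \<in> {Y. toh_score G n h Y \<ge> q * N + s}}"
    then have "s \<le> toh_score G n h y - q * N"
      by (simp add: toh_score_matrix)
    from mult_left_mono[OF this \<open>0 \<le> l\<close>]
    show "l * (real (card {x \<in> toh_pairs n. y x = ?c x}) - q * real (card (toh_pairs n))) \<ge> l * s"
      by (simp add: N_def toh_score_def)
  qed simp
  also have "\<dots> \<le> exp (real (card (toh_pairs n)) * (q * (1 - q) * l\<^sup>2 * exp \<bar>l\<bar> / 2) - l * s)"
  proof (rule Chernoff_matches)
    \<comment> \<open>Without signal every entry is uniform whatever \<open>g\<close> is, so it
      agrees with the fixed \<open>h\<close> with probability \<open>q\<close>.\<close>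
    fix x assume "x \<in> toh_pairs n"
    then show "pmf (?P x) (?c x) = q"
      using pmf_toh_entry[OF assms(1,2) _ _ c] by (auto simp: q_def split: prod.splits)
  qed (use ord in \<open>auto simp: q_def\<close>)
  finally show "measure_pmf.prob (Pi_pmf (toh_pairs n) undefined ?P)
      {y. toh_matrix G n y \<in> {Y. toh_score G n h Y \<ge> q * N + s}}
    \<le> exp (N * (q * (1 - q) * l\<^sup>2 * exp l / 2) - l * s)"
    using \<open>0 \<le> l\<close> by (simp add: N_def)
qed

text \<open>If all scores are small, so is that of the planted labelling. Only this one lower tail
  has to be bounded, with no union bound.\<close>

lemma prob_spiked_all_scores_less:
  fixes G :: "('a, 'b) monoid_scheme" and n :: nat and l s pt :: real
  assumes "group G" "finite (carrier G)" "0 \<le> pt / sqrt (real n)" "pt / sqrt (real n) \<le> 1" "0 \<le> l"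
  defines "q \<equiv> 1 / real (order G)" and "N \<equiv> real (card (toh_pairs n))"
  shows "measure_pmf.prob (ToH n pt G) {Y. \<forall>h\<in>{..<n} \<rightarrow>\<^sub>E carrier G. toh_score G n h Y < q * N + s}
    \<le> exp (N * (l\<^sup>2 * exp l / 8) - l * (N * (1 - q) * (pt / sqrt (real n)) - s))"
proof (rule prob_ToH_le[OF assms(1,2)])
  interpret group G by fact
  fix g assume g: "g \<in> {..<n} \<rightarrow>\<^sub>E carrier G"
  define p where "p = pt / sqrt (real n)"
  \<comment> \<open>The planted labelling matches an entry that tells the truth, or a noisy one by
    chance. The gain over a random match is \<open>r - q = (1 - q) * p\<close>.\<close>
  define r where "r = p + (1 - p) * q"
  let ?M = "Pi_pmf (toh_pairs n) undefined (\<lambda>(u, v). toh_entry G (pt / sqrt (real n)) (g u) (g v))"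
  let ?c = "\<lambda>x. g (fst x) \<otimes>\<^bsub>G\<^esub> inv\<^bsub>G\<^esub> (g (snd x))"
  have p: "0 \<le> p" "p \<le> 1"
    using assms by (auto simp: p_def)
  have "order G > 0"
    using assms(2) order_gt_0_iff_finite by blast
  then have q: "0 \<le> q" "q \<le> 1"
    by (auto simp: q_def)
  have r: "0 \<le> r" "r \<le> 1"
    using p q mult_left_mono[of q 1 "1 - p"] by (auto simp: r_def)
  \<comment> \<open>Replacing the variance by 1/4 is affordable here, since the tail need not beat
    an exponential number of labellings.\<close>
  have r_var: "r * (1 - r) \<le> 1 / 4"
    using zero_le_power2[of "2 * r - 1"] by (simp add: power2_eq_square algebra_simps)
  have c: "?c x \<in> carrier G" if "x \<in> toh_pairs n" for x
    using that g by (auto simp: toh_pairs_def PiE_iff)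
  have "measure_pmf.prob ?M
      {y. toh_matrix G n y \<in> {Y. \<forall>h\<in>{..<n} \<rightarrow>\<^sub>E carrier G. toh_score G n h Y < q * N + s}}
    \<le> measure_pmf.prob ?M
      {y. - l * (real (card {x \<in> toh_pairs n. y x = ?c x}) - r * real (card (toh_pairs n)))
        \<ge> l * (N * (1 - q) * p - s)}"
  proof (intro measure_pmf.finite_measure_mono subsetI CollectI)
    fix y assume "y \<in> {y. toh_matrix G n y \<in>
      {Y. \<forall>h\<in>{..<n} \<rightarrow>\<^sub>E carrier G. toh_score G n h Y < q * N + s}}"
    then have "toh_score G n g y < q * N + s"
      using g by (simp add: toh_score_matrix)
    then have "N * (1 - q) * p - s \<le> r * N - toh_score G n g y"
      by (simp add: r_def algebra_simps)
    from mult_left_mono[OF this \<open>0 \<le> l\<close>]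
    show "- l * (real (card {x \<in> toh_pairs n. y x = ?c x}) - r * real (card (toh_pairs n)))
        \<ge> l * (N * (1 - q) * p - s)"
      by (simp add: N_def toh_score_def algebra_simps)
  qed simp
  also have "\<dots> \<le> exp (real (card (toh_pairs n)) * (r * (1 - r) * (- l)\<^sup>2 * exp \<bar>- l\<bar> / 2)
      - l * (N * (1 - q) * p - s))"
  proof (rule Chernoff_matches)
    fix x assume "x \<in> toh_pairs n"
    then show "pmf ((\<lambda>(u, v). toh_entry G (pt / sqrt (real n)) (g u) (g v)) x) (?c x) = r"
      using pmf_toh_entry[OF assms(1,2) p c]
      by (auto simp: q_def r_def p_def split: prod.splits)
  qed (use r in auto)
  also have "\<dots> \<le> exp (N * (l\<^sup>2 * exp l / 8) - l * (N * (1 - q) * p - s))"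
  proof -
    have "r * (1 - r) * (l\<^sup>2 * exp l / 2) \<le> 1 / 4 * (l\<^sup>2 * exp l / 2)"
      by (intro mult_right_mono r_var) auto
    then have "N * (r * (1 - r) * l\<^sup>2 * exp l / 2) \<le> N * (l\<^sup>2 * exp l / 8)"
      by (intro mult_left_mono) (auto simp: N_def)
    then show ?thesis
      using \<open>0 \<le> l\<close> by (simp add: N_def)
  qed
  finally show "measure_pmf.prob ?M
      {y. toh_matrix G n y \<in> {Y. \<forall>h\<in>{..<n} \<rightarrow>\<^sub>E carrier G. toh_score G n h Y < q * N + s}}
    \<le> exp (N * (l\<^sup>2 * exp l / 8) - l * (N * (1 - q) * (pt / sqrt (real n)) - s))"
    by (simp add: p_def)
qed

text \<open>Union bound: the L^n labellings contribute \<open>real n * ln (real (order G))\<close>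
  to the exponent. Extensionality makes the set of labellings finite with exactly this size.\<close>

lemma prob_null_some_score_ge:
  fixes G :: "('a, 'b) monoid_scheme" and n :: nat and l s :: real
  assumes "group G" "finite (carrier G)" "0 \<le> l"
  defines "q \<equiv> 1 / real (order G)" and "N \<equiv> real (card (toh_pairs n))"
  shows "measure_pmf.prob (ToH n 0 G) {Y. \<exists>h\<in>{..<n} \<rightarrow>\<^sub>E carrier G. toh_score G n h Y \<ge> q * N + s}
    \<le> exp (real n * ln (real (order G)) + N * (q * (1 - q) * l\<^sup>2 * exp l / 2) - l * s)"
proof -
  interpret group G by fact
  let ?H = "{..<n} \<rightarrow>\<^sub>E carrier G"
  have ord: "order G > 0"
    using assms(2) order_gt_0_iff_finite by blast
  have "measure_pmf.prob (ToH n 0 G) {Y. \<exists>h\<in>?H. toh_score G n h Y \<ge> q * N + s}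
      = measure_pmf.prob (ToH n 0 G) (\<Union>h\<in>?H. {Y. toh_score G n h Y \<ge> q * N + s})"
    by (intro arg_cong[where f = "measure_pmf.prob (ToH n 0 G)"]) auto
  also have "\<dots> \<le> (\<Sum>h\<in>?H. measure_pmf.prob (ToH n 0 G) {Y. toh_score G n h Y \<ge> q * N + s})"
    using assms(2) by (intro measure_UNION_le finite_PiE) auto
  also have "\<dots> \<le> (\<Sum>h\<in>?H. exp (N * (q * (1 - q) * l\<^sup>2 * exp l / 2) - l * s))"
    unfolding q_def N_def by (intro sum_mono prob_null_score_ge assms) auto
  also have "\<dots> = real (order G) ^ n * exp (N * (q * (1 - q) * l\<^sup>2 * exp l / 2) - l * s)"
    by (simp add: card_PiE order_def)
  also have "real (order G) ^ n = exp (real n * ln (real (order G)))"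
    using ord by (simp add: exp_of_nat_mult)
  finally show ?thesis
    by (simp add: exp_add[symmetric] add_diff_eq)
qed

section \<open>Asymptotics of the two exponents\<close>

lemma null_rate_tendsto:
  fixes a b c d :: real
  assumes "c - a * b + d * a\<^sup>2 / 4 < 0"
  shows "(\<lambda>n. exp (real n * c + real n * (real n - 1) / 2 *
      (d * (a / sqrt (real n))\<^sup>2 * exp (a / sqrt (real n)) / 2)
      - a / sqrt (real n) * (b * (real n * sqrt (real n))))) \<longlonglongrightarrow> 0"
proof -
  \<comment> \<open>\<open>r n\<close> is the exponent divided by n. With parameter
    \<open>a / sqrt (real n)\<close> the entropy, variance and threshold terms are all of order n,
    and \<open>r\<close> tends to the quantity assumed negative.\<close>
  define r where "r n = c + (real n - 1) / real n * (d * a\<^sup>2 / 4) * exp (a / sqrt (real n)) - a * b"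
    for n :: nat
  have "(\<lambda>n. (real n - 1) / real n) \<longlonglongrightarrow> 1" "(\<lambda>n. exp (a / sqrt (real n))) \<longlonglongrightarrow> 1"
    by real_asymp+
  then have "r \<longlonglongrightarrow> c + 1 * (d * a\<^sup>2 / 4) * 1 - a * b"
    unfolding r_def by (intro tendsto_intros)
  moreover have "filterlim (\<lambda>n. real n) at_top sequentially"
    by (rule filterlim_real_sequentially)
  ultimately have "filterlim (\<lambda>n. r n * real n) at_bot sequentially"
    using assms by (intro filterlim_tendsto_neg_mult_at_bot) (auto simp: algebra_simps)
  then have "(\<lambda>n. exp (r n * real n)) \<longlonglongrightarrow> 0"
    by (rule filterlim_compose[OF exp_at_bot])
  moreover have "eventually (\<lambda>n. exp (r n * real n) = exp (real n * c + real n * (real n - 1) / 2 *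
      (d * (a / sqrt (real n))\<^sup>2 * exp (a / sqrt (real n)) / 2)
      - a / sqrt (real n) * (b * (real n * sqrt (real n))))) sequentially"
    using eventually_gt_at_top[of 0]
  proof eventually_elim
    case (elim n)
    \<comment> \<open>In terms of the square root of n the identity is rational and
      \<open>field_simps\<close> decides it.\<close>
    define x where "x = sqrt (real n)"
    have "x > 0" and n: "real n = x\<^sup>2"
      using elim by (auto simp: x_def)
    have "(c + (x\<^sup>2 - 1) / x\<^sup>2 * (d * a\<^sup>2 / 4) * e - a * b) * x\<^sup>2
      = x\<^sup>2 * c + x\<^sup>2 * (x\<^sup>2 - 1) / 2 * (d * (a / x)\<^sup>2 * e / 2) - a / x * (b * (x\<^sup>2 * x))" for e
      using \<open>x > 0\<close> by (simp add: field_simps power2_eq_square)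
    then show ?case
      unfolding r_def x_def[symmetric] unfolding n by simp
  qed
  ultimately show ?thesis
    by (rule Lim_transform_eventually)
qed

text \<open>With parameter 1/n the variance term stays bounded (it tends to 1/16), while the linear
  term is about \<open>-(k / 2 - b) * sqrt (real n)\<close>.\<close>

lemma spiked_rate_tendsto:
  fixes b k :: real
  assumes "b < k / 2"
  shows "(\<lambda>n. exp (real n * (real n - 1) / 2 * ((1 / real n)\<^sup>2 * exp (1 / real n) / 8)
      - 1 / real n * (real n * (real n - 1) / 2 * (k / sqrt (real n))
        - b * (real n * sqrt (real n))))) \<longlonglongrightarrow> 0"
proof -
  have "k / 2 - b > 0"
    using assms by simp
  then show ?thesis
    by real_asymp
qed

section \<open>Choice of the threshold and convergence of both errors\<close>

theorem theorem6p17: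
  fixes G :: "('a, 'b) monoid_scheme" and L :: nat and pt :: real
  assumes "group G" and "finite (carrier G)"
    and "order G = L" and "L \<ge> 2"
    and "pt > sqrt (4 * ln (real L) / (real L - 1))"
  shows "\<exists>test :: nat \<Rightarrow> (nat \<times> nat \<Rightarrow> 'a) \<Rightarrow> bool.
      ((\<lambda>n. type_I_error (ToH n 0 G) (test n)) \<longlonglongrightarrow> 0) \<and>
      ((\<lambda>n. type_II_error (ToH n pt G) (test n)) \<longlonglongrightarrow> 0)"
proof -
  define q where "q = 1 / real L"
  define d where "d = q * (1 - q)"
  have q: "0 < q" "q < 1"
    using \<open>L \<ge> 2\<close> by (auto simp: q_def)
  then have d: "d > 0"
    by (simp add: d_def)
  have "sqrt (4 * ln (real L) / (real L - 1)) \<ge> 0"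
    using \<open>L \<ge> 2\<close> by simp
  then have pt: "pt > 0"
    using assms(5) by linarith
  \<comment> \<open>The hypothesis on \<open>pt\<close>, squared and multiplied by
    \<open>(1 - q)\<^sup>2\<close>: since \<open>(1 - q) / (L - 1) = q\<close>, the factor
    \<open>(1 - q)\<^sup>2 / (L - 1)\<close> is the variance \<open>d\<close>.\<close>
  have "sqrt (d * ln (real L)) < (1 - q) * pt / 2"
  proof (rule real_less_lsqrt)
    have "4 * ln (real L) / (real L - 1) < pt\<^sup>2"
      using assms(5) pt real_sqrt_less_iff[of _ "pt\<^sup>2"] by simp
    then have "(1 - q) * (1 - q) * (4 * ln (real L) / (real L - 1)) < (1 - q) * (1 - q) * pt\<^sup>2"
      using q by (intro mult_strict_left_mono) auto
    moreover have "(1 - q) * (1 - q) * (4 * ln (real L) / (real L - 1)) = 4 * (d * ln (real L))"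
      using \<open>L \<ge> 2\<close> by (simp add: d_def q_def field_simps)
    ultimately show "d * ln (real L) < ((1 - q) * pt / 2)\<^sup>2"
      by (simp add: power2_eq_square algebra_simps)
  qed (use q pt in auto)
  then obtain b where b: "sqrt (d * ln (real L)) < b" "b < (1 - q) * pt / 2"
    using dense by blast
  have "0 \<le> d * ln (real L)"
    using d \<open>L \<ge> 2\<close> by simp
  then have b0: "b > 0"
    using b(1) real_sqrt_ge_zero by (meson order.strict_trans1)
  have b2: "d * ln (real L) < b\<^sup>2"
    using b(1) real_le_rsqrt by (meson not_le)
  define s where "s n = b * (real n * sqrt (real n))" for n
  define N where "N n = real (card (toh_pairs n))" for n
  define test where
    "test n Y \<longleftrightarrow> (\<exists>h\<in>{..<n} \<rightarrow>\<^sub>E carrier G. toh_score G n h Y \<ge> q * N n + s n)" for n Y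
  have "(\<lambda>n. type_I_error (ToH n 0 G) (test n)) \<longlonglongrightarrow> 0"
  proof (rule tendsto_sandwich[OF _ _ tendsto_const])
    \<comment> \<open>This \<open>a\<close> minimises
      \<open>ln L - a * b + d * a\<^sup>2 / 4\<close>; the minimum is
      \<open>ln L - b\<^sup>2 / d\<close>, negative by the choice of \<open>b\<close>.\<close>
    define a where "a = 2 * b / d"
    have "ln (real L) - a * b + d * a\<^sup>2 / 4 = (d * ln (real L) - b\<^sup>2) / d"
      using d by (simp add: a_def field_simps power2_eq_square)
    also have "\<dots> < 0"
      using b2 d by (simp add: divide_less_0_iff)
    finally show "(\<lambda>n. exp (real n * ln (real L) + real n * (real n - 1) / 2 *
      (d * (a / sqrt (real n))\<^sup>2 * exp (a / sqrt (real n)) / 2)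
      - a / sqrt (real n) * (b * (real n * sqrt (real n))))) \<longlonglongrightarrow> 0"
      by (rule null_rate_tendsto)
    have "0 \<le> a"
      using b0 d by (simp add: a_def)
    then show "\<forall>\<^sub>F n in sequentially. type_I_error (ToH n 0 G) (test n)
      \<le> exp (real n * ln (real L) + real n * (real n - 1) / 2 *
      (d * (a / sqrt (real n))\<^sup>2 * exp (a / sqrt (real n)) / 2)
      - a / sqrt (real n) * (b * (real n * sqrt (real n))))"
      using prob_null_some_score_ge[OF assms(1,2), of "a / sqrt (real n)" n "s n" for n]
      by (intro always_eventually allI)
        (simp add: type_I_error_def test_def N_def s_def d_def q_def card_toh_pairs assms(3))
  qed (simp add: type_I_error_def)
  moreover have "(\<lambda>n. type_II_error (ToH n pt G) (test n)) \<longlonglongrightarrow> 0"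
  proof (rule tendsto_sandwich[OF _ _ tendsto_const])
    show "(\<lambda>n. exp (real n * (real n - 1) / 2 * ((1 / real n)\<^sup>2 * exp (1 / real n) / 8)
      - 1 / real n * (real n * (real n - 1) / 2 * ((1 - q) * pt / sqrt (real n))
        - b * (real n * sqrt (real n))))) \<longlonglongrightarrow> 0"
      by (rule spiked_rate_tendsto) (rule b(2))
    \<comment> \<open>The spiked bound requires a genuine Bernoulli parameter, hence holds only
      eventually; the null bound has parameter 0 and holds for every n.\<close>
    have "\<forall>\<^sub>F n in sequentially. pt / sqrt (real n) \<le> 1"
      by real_asymp
    then show "\<forall>\<^sub>F n in sequentially. type_II_error (ToH n pt G) (test n)
      \<le> exp (real n * (real n - 1) / 2 * ((1 / real n)\<^sup>2 * exp (1 / real n) / 8)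
      - 1 / real n * (real n * (real n - 1) / 2 * ((1 - q) * pt / sqrt (real n))
        - b * (real n * sqrt (real n))))"
    proof eventually_elim
      case (elim n)
      then show ?case
        using prob_spiked_all_scores_less[OF assms(1,2) _ elim, of "1 / real n" "s n"] pt
        by (simp add: type_II_error_def test_def not_le N_def s_def q_def card_toh_pairs assms(3)
            mult.assoc)
    qed
  qed (simp add: type_II_error_def)
  ultimately show ?thesis
    by blast
qed

end
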